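(* Let $X$ be a set, and let $G$ be a subgroup of $\mathrm{Sym}(X)$. Let $I$ be an index set for the set of orbits of $G$ on $X$, and let $\{\alpha_i:i\in I\}\subseteq X$ be a complete set of representatives for the orbits of $G$ (exactly one $\alpha_i$ from each orbit). For each $i\in I$ let $\pi_i\in G$, and suppose that \[ C_G(\pi_i)\geq G_{\alpha_i}\quad\text{for all } i\in I. \] Let $f:X\to\mathrm{Sym}(X)$ be defined by \[ (\alpha_i g)f=g^{-1}\pi_i g\quad\text{for } g\in G \text{ and } i\in I. \] Define $x\vartriangleright y=x(yf)$ for all $x,y\in X$. Then $(X,\vartriangleright)$ is a rack with operator group contained in $G$. If moreover \[ G=\langle g^{-1}\pi_i g: g\in G,\ i\in I\rangle, \] then the operator group of $(X,\vartriangleright)$ is equal to $G$.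
   Context: A rack is a set $X$ together with a binary operation $\vartriangleright:X\times X\to X$ such that (i) for all $y\in X$ the map $f_y:X\to X$, $x\mapsto x\vartriangleright y$, is a bijection; and (ii) for all $x,y,z\in X$, $(x\vartriangleright y)\vartriangleright z=(x\vartriangleright z)\vartriangleright(y\vartriangleright z)$. Racks need not be finite. The operator group of a rack $(X,\vartriangleright)$ is the subgroup of $\mathrm{Sym}(X)$ generated by $\{f_y:y\in X\}$; it is a permutation group on $X$. $\mathrm{Sym}(X)$ is the symmetric group on $X$; permutations and maps are written on the right of their arguments and composed from left to right, so $x(gh)=(xg)h$. For a group $G\leq\mathrm{Sym}(X)$, $C_G(\pi)$ denotes the centraliser of $\pi\in G$ in $G$, and $G_\alpha$ denotes the point stabiliser of $\alpha\in X$ in $G$. The condition $C_G(\pi_i)\geq G_{\alpha_i}$ makes the map $f$ well defined. *)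

theory Defs
  imports "HOL-Algebra.Group_Action" "HOL-Algebra.Generated_Groups"
begin

(* Sym(X) is BijGroup X: the bijections of X, extensional outside X, with g \<otimes> h being
   "h first, then g".  The product gh of permutations that act on the right is therefore
   h \<otimes> g, and the conjugate g^{-1} p g of the right-action convention is g \<otimes> p \<otimes> inv g.
   A permutation group on X is a subgroup of BijGroup X, acting on X via \<lambda>g. g. *)

locale rack =
  fixes X :: "'a set" and rop :: "'a \<Rightarrow> 'a \<Rightarrow> 'a" (infixl "\<rhd>" 70)
  assumes closed: "\<lbrakk>x \<in> X; y \<in> X\<rbrakk> \<Longrightarrow> x \<rhd> y \<in> X"
    and bij: "y \<in> X \<Longrightarrow> bij_betw (\<lambda>x. x \<rhd> y) X X"
    and self_distrib:
      "\<lbrakk>x \<in> X; y \<in> X; z \<in> X\<rbrakk> \<Longrightarrow> (x \<rhd> y) \<rhd> z = (x \<rhd> z) \<rhd> (y \<rhd> z)"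

definition operator_group :: "'a set \<Rightarrow> ('a \<Rightarrow> 'a \<Rightarrow> 'a) \<Rightarrow> ('a \<Rightarrow> 'a) set" where
  "operator_group X rop = generate (BijGroup X) {\<lambda>x \<in> X. rop x y | y. y \<in> X}"

definition centraliser :: "('a, 'b) monoid_scheme \<Rightarrow> 'a \<Rightarrow> 'a set" where
  "centraliser G p = {g \<in> carrier G. g \<otimes>\<^bsub>G\<^esub> p = p \<otimes>\<^bsub>G\<^esub> g}"

abbreviation perm_group :: "'a set \<Rightarrow> ('a \<Rightarrow> 'a) set \<Rightarrow> ('a \<Rightarrow> 'a) monoid" where
  "perm_group X G \<equiv> (BijGroup X)\<lparr>carrier := G\<rparr>"

abbreviation perm_conj :: "'a set \<Rightarrow> ('a \<Rightarrow> 'a) \<Rightarrow> ('a \<Rightarrow> 'a) \<Rightarrow> ('a \<Rightarrow> 'a)" where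
  "perm_conj X g p \<equiv> g \<otimes>\<^bsub>BijGroup X\<^esub> p \<otimes>\<^bsub>BijGroup X\<^esub> inv\<^bsub>BijGroup X\<^esub> g"

definition orbit_reps ::
  "'a set \<Rightarrow> ('a \<Rightarrow> 'a) set \<Rightarrow> 'i set \<Rightarrow> ('i \<Rightarrow> 'a) \<Rightarrow> bool" where
  "orbit_reps X G I \<alpha> \<longleftrightarrow>
     \<alpha> \<in> I \<rightarrow> X \<and>
     (\<forall>Q \<in> orbits (perm_group X G) X (\<lambda>g. g). \<exists>!i. i \<in> I \<and> \<alpha> i \<in> Q)"

(* The defining equations of f are a condition on f, so that their consistency
   (f is well defined) can be stated as a claim. *)
definition is_conj_map ::
  "'a set \<Rightarrow> ('a \<Rightarrow> 'a) set \<Rightarrow> 'i set \<Rightarrow> ('i \<Rightarrow> 'a) \<Rightarrow> ('i \<Rightarrow> 'a \<Rightarrow> 'a) \<Rightarrow> ('a \<Rightarrow> 'a \<Rightarrow> 'a) \<Rightarrow> bool" where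
  "is_conj_map X G I \<alpha> \<pi> f \<longleftrightarrow>
     f \<in> X \<rightarrow> carrier (BijGroup X) \<and>
     (\<forall>i \<in> I. \<forall>g \<in> G. f (g (\<alpha> i)) = perm_conj X g (\<pi> i))"

end

theory Submission
  imports Defs
begin

text \<open>If \<open>g\<close> and \<open>h\<close> move \<open>\<alpha>\<^sub>i\<close> to the same point, then \<open>g\<close> and \<open>h\<close> differ by an element
  of the stabiliser of \<open>\<alpha>\<^sub>i\<close>, which commutes with \<open>\<pi>\<^sub>i\<close>; so \<open>g\<close> and \<open>h\<close> conjugate \<open>\<pi>\<^sub>i\<close> to the same
  permutation and \<open>f\<close> is well defined. It is \<open>G\<close>-equivariant with respect to conjugation, and
  equivariance under the particular elements \<open>f z\<close> of \<open>G\<close> is exactly the self-distributive law.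
  The operators of the rack are the conjugates of the \<open>\<pi>\<^sub>i\<close>, which lie in \<open>G\<close>.\<close>

text \<open>With \<open>k = inv h \<otimes> g\<close> one has \<open>g = h \<otimes> k\<close>;
  since \<open>k\<close> commutes with \<open>p\<close>, it slides past \<open>p\<close> and
  cancels, leaving only \<open>h\<close>.\<close>

lemma (in group) conj_eq_if_commute:
  assumes "g \<in> carrier G" "h \<in> carrier G" "p \<in> carrier G"
    and comm: "(inv h \<otimes> g) \<otimes> p = p \<otimes> (inv h \<otimes> g)"
  shows "g \<otimes> p \<otimes> inv g = h \<otimes> p \<otimes> inv h"
proof -
  have "g \<otimes> p \<otimes> inv g = h \<otimes> ((inv h \<otimes> g) \<otimes> p) \<otimes> inv g"
    using assms(1-3) by (simp flip: m_assoc)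
  also have "\<dots> = h \<otimes> p \<otimes> inv h"
    unfolding comm using assms(1-3) by (simp add: m_assoc)
  finally show ?thesis .
qed

lemma (in group) conj_mult:
  assumes "g \<in> carrier G" "h \<in> carrier G" "p \<in> carrier G"
  shows "(h \<otimes> g) \<otimes> p \<otimes> inv (h \<otimes> g) = h \<otimes> (g \<otimes> p \<otimes> inv g) \<otimes> inv h"
  using assms by (simp add: m_assoc inv_mult_group)

lemma BijGroup_mult_apply:
  assumes "g \<in> carrier (BijGroup X)" "h \<in> carrier (BijGroup X)" "x \<in> X"
  shows "(g \<otimes>\<^bsub>BijGroup X\<^esub> h) x = g (h x)"
  using assms by (simp add: BijGroup_def compose_eq)

text \<open>Conjugation by \<open>g\<close> transports the action of \<open>p\<close> along
  \<open>g\<close>. With \<open>g = f z\<close> and \<open>p = f y\<close> this becomes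
  self-distributivity.\<close>

lemma BijGroup_conj_apply:
  assumes "g \<in> carrier (BijGroup X)" "p \<in> carrier (BijGroup X)" "x \<in> X"
  shows "perm_conj X g p (g x) = g (p x)"
proof -
  interpret group "BijGroup X" by (rule group_BijGroup)
  have "g x \<in> X"
    using assms by (auto simp: BijGroup_def dest: Bij_imp_funcset)
  then have "perm_conj X g p (g x) = (perm_conj X g p \<otimes>\<^bsub>BijGroup X\<^esub> g) x"
    using assms by (simp add: BijGroup_mult_apply)
  also have "perm_conj X g p \<otimes>\<^bsub>BijGroup X\<^esub> g = g \<otimes>\<^bsub>BijGroup X\<^esub> p"
    using assms by (simp add: m_assoc)
  finally show ?thesis
    using assms by (simp add: BijGroup_mult_apply)
qed

lemma perm_group_action:
  assumes "subgroup G (BijGroup X)"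
  shows "group_action (perm_group X G) X (\<lambda>g. g)"
  using assms group.subgroup_imp_group[OF group_BijGroup assms] group_BijGroup[of X]
  by (auto simp: group_action_def group_hom_def group_hom_axioms_def hom_def
      dest: subgroup.mem_carrier)

locale conj_rack_data =
  fixes X :: "'a set" and G :: "('a \<Rightarrow> 'a) set" and I :: "'i set"
    and \<alpha> :: "'i \<Rightarrow> 'a" and \<pi> :: "'i \<Rightarrow> 'a \<Rightarrow> 'a"
  assumes subgroup_G: "subgroup G (BijGroup X)"
    and reps: "orbit_reps X G I \<alpha>"
    and \<pi>_in_G: "i \<in> I \<Longrightarrow> \<pi> i \<in> G"
    and stabilizer_le_centraliser:
      "i \<in> I \<Longrightarrow>
        stabilizer (perm_group X G) (\<lambda>g. g) (\<alpha> i) \<subseteq> centraliser (perm_group X G) (\<pi> i)"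
begin

sublocale Sym: group "BijGroup X"
  by (rule group_BijGroup)

sublocale G: subgroup G "BijGroup X"
  by (rule subgroup_G)

sublocale group_action "perm_group X G" X "\<lambda>g. g"
  by (rule perm_group_action[OF subgroup_G])

lemma \<alpha>_in_X: "i \<in> I \<Longrightarrow> \<alpha> i \<in> X"
  using reps by (auto simp: orbit_reps_def)

lemma G_apply_in_X: "\<lbrakk>g \<in> G; x \<in> X\<rbrakk> \<Longrightarrow> g x \<in> X"
  using element_image[of g x] by simp

lemma point_eq_rep_image:
  assumes "x \<in> X"
  obtains i g where "i \<in> I" "g \<in> G" "x = g (\<alpha> i)"
proof -
  have "orbit (perm_group X G) (\<lambda>g. g) x \<in> orbits (perm_group X G) X (\<lambda>g. g)"
    using assms by (auto simp: orbits_def)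
  then obtain i where i: "i \<in> I" "\<alpha> i \<in> orbit (perm_group X G) (\<lambda>g. g) x"
    using reps unfolding orbit_reps_def by blast
  \<comment> \<open>\<open>orbit_reps\<close> places the representative in the orbit of
    \<open>x\<close>; symmetry turns this round, making \<open>x\<close> an image of
    \<open>\<alpha> i\<close>.\<close>
  then have "x \<in> orbit (perm_group X G) (\<lambda>g. g) (\<alpha> i)"
    using orbit_sym[OF assms] \<alpha>_in_X by blast
  then show ?thesis
    using i(1) that by (auto simp: orbit_def)
qed

lemma inv_apply_eq:
  assumes "g \<in> G" "h \<in> G" "x \<in> X" "y \<in> X" "g x = h y"
  shows "(inv\<^bsub>BijGroup X\<^esub> h \<otimes>\<^bsub>BijGroup X\<^esub> g) x = y"
  \<comment> \<open>\<open>orbit_sym_aux\<close> uses the inverse of \<open>perm_group X G\<close>,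
    which \<open>m_inv_consistent\<close> identifies with the one in
    \<open>BijGroup X\<close>.\<close>
  using orbit_sym_aux[of h y "g x"] composition_rule[of x "inv\<^bsub>BijGroup X\<^esub> h" g] assms
  by (simp add: Sym.m_inv_consistent[OF subgroup_G])

text \<open>The element \<open>inv h \<otimes> g\<close> of \<open>G\<close> carries
  \<open>\<alpha> i\<close> to \<open>\<alpha> j\<close>, so both lie in one orbit, which has a
  single representative.\<close>

lemma rep_unique:
  assumes "i \<in> I" "j \<in> I" "g \<in> G" "h \<in> G" "g (\<alpha> i) = h (\<alpha> j)"
  shows "i = j"
proof -
  let ?k = "inv\<^bsub>BijGroup X\<^esub> h \<otimes>\<^bsub>BijGroup X\<^esub> g" and ?Q = "orbit (perm_group X G) (\<lambda>g. g) (\<alpha> i)"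
  have "?k (\<alpha> i) = \<alpha> j"
    using inv_apply_eq assms \<alpha>_in_X by blast
  moreover have "?k \<in> G"
    using assms by simp
  ultimately have "\<alpha> j \<in> ?Q"
    unfolding orbit_def by (intro CollectI exI[of _ ?k]) simp
  moreover have "\<alpha> i \<in> ?Q"
    using orbit_refl \<alpha>_in_X assms(1) by blast
  moreover have "?Q \<in> orbits (perm_group X G) X (\<lambda>g. g)"
    using \<alpha>_in_X assms(1) by (auto simp: orbits_def)
  ultimately show ?thesis
    using reps assms(1,2) unfolding orbit_reps_def by blast
qed

lemma perm_conj_in_G: "\<lbrakk>g \<in> G; p \<in> G\<rbrakk> \<Longrightarrow> perm_conj X g p \<in> G"
  by simp

lemma perm_conj_well_defined:
  assumes "i \<in> I" "j \<in> I" "g \<in> G" "h \<in> G" "g (\<alpha> i) = h (\<alpha> j)"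
  shows "perm_conj X g (\<pi> i) = perm_conj X h (\<pi> j)"
proof -
  let ?k = "inv\<^bsub>BijGroup X\<^esub> h \<otimes>\<^bsub>BijGroup X\<^esub> g"
  have [simp]: "j = i"
    using rep_unique[OF assms] by simp
  have "?k (\<alpha> i) = \<alpha> i"
    using inv_apply_eq assms \<alpha>_in_X by simp
  then have "?k \<in> stabilizer (perm_group X G) (\<lambda>g. g) (\<alpha> i)"
    using assms by (simp add: stabilizer_def)
  then have "?k \<otimes>\<^bsub>BijGroup X\<^esub> \<pi> i = \<pi> i \<otimes>\<^bsub>BijGroup X\<^esub> ?k"
    using stabilizer_le_centraliser[OF assms(1)] by (auto simp: centraliser_def)
  then show ?thesis
    using Sym.conj_eq_if_commute[of g h "\<pi> i"] assms \<pi>_in_G by simp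
qed

lemma ex_conj_map: "\<exists>f. f \<in> extensional X \<and> is_conj_map X G I \<alpha> \<pi> f"
proof -
  \<comment> \<open>One value \<open>c\<close> serves all presentations of \<open>x\<close> as
    \<open>g (\<alpha> i)\<close>, so choosing such a \<open>c\<close> for each \<open>x\<close>
    yields a function \<open>F\<close> satisfying every equation.\<close>
  have "\<exists>c. \<forall>i \<in> I. \<forall>g \<in> G. x = g (\<alpha> i) \<longrightarrow> c = perm_conj X g (\<pi> i)" if "x \<in> X" for x
    using point_eq_rep_image[OF that] perm_conj_well_defined by metis
  then obtain F where
    F: "perm_conj X g (\<pi> i) = F (g (\<alpha> i))" if "g (\<alpha> i) \<in> X" "i \<in> I" "g \<in> G" for g i
    by metis
  have "F x \<in> carrier (BijGroup X)" if "x \<in> X" for x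
    using point_eq_rep_image[OF that] F that perm_conj_in_G \<pi>_in_G G.mem_carrier by metis
  then have "is_conj_map X G I \<alpha> \<pi> (restrict F X)"
    using F G_apply_in_X \<alpha>_in_X by (auto simp: is_conj_map_def)
  then show ?thesis
    by (meson restrict_extensional)
qed

text \<open>Every point of \<open>X\<close> has the form \<open>g (\<alpha> i)\<close>, so the
  equations fix the values on \<open>X\<close>; extensionality fixes those outside.\<close>

lemma conj_map_unique:
  assumes "f \<in> extensional X" "is_conj_map X G I \<alpha> \<pi> f"
    and "f' \<in> extensional X" "is_conj_map X G I \<alpha> \<pi> f'"
  shows "f = f'"
proof (rule extensionalityI[OF assms(1,3)])
  fix x assume "x \<in> X"
  then show "f x = f' x"
    using assms(2,4) by (elim point_eq_rep_image) (simp add: is_conj_map_def)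
qed

context
  fixes f
  assumes f: "is_conj_map X G I \<alpha> \<pi> f"
begin

lemma conj_map_rep: "\<lbrakk>i \<in> I; g \<in> G\<rbrakk> \<Longrightarrow> f (g (\<alpha> i)) = perm_conj X g (\<pi> i)"
  using f by (simp add: is_conj_map_def)

lemma conj_map_in_G: "x \<in> X \<Longrightarrow> f x \<in> G"
  by (elim point_eq_rep_image) (simp add: conj_map_rep \<pi>_in_G)

text \<open>If \<open>g\<close> takes \<open>\<alpha> i\<close> to \<open>x\<close>, then
  \<open>h \<otimes> g\<close> takes it to \<open>h x\<close>, and conjugating by a product means
  conjugating twice.\<close>

lemma conj_map_equivariant:
  assumes "x \<in> X" "h \<in> G"
  shows "f (h x) = perm_conj X h (f x)"
proof -
  obtain i g where ig: "i \<in> I" "g \<in> G" "x = g (\<alpha> i)"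
    using assms(1) by (rule point_eq_rep_image)
  have "h x = (h \<otimes>\<^bsub>BijGroup X\<^esub> g) (\<alpha> i)"
    using ig assms(2) \<alpha>_in_X by (simp add: BijGroup_mult_apply)
  then have "f (h x) = perm_conj X (h \<otimes>\<^bsub>BijGroup X\<^esub> g) (\<pi> i)"
    using conj_map_rep[OF ig(1), of "h \<otimes>\<^bsub>BijGroup X\<^esub> g"] ig(2) assms(2) by simp
  also have "\<dots> = perm_conj X h (f x)"
    using Sym.conj_mult[of g h "\<pi> i"] ig assms(2) \<pi>_in_G conj_map_rep by simp
  finally show ?thesis .
qed

lemma rack_conj_map: "rack X (\<lambda>x y. f y x)"
proof
  show "f y x \<in> X" if "x \<in> X" "y \<in> X" for x y
    using that conj_map_in_G G_apply_in_X by blast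
  show "bij_betw (f y) X X" if "y \<in> X" for y
    using bij_prop0[of "f y"] conj_map_in_G[OF that] by (simp add: Bij_def)
  \<comment> \<open>Equivariance under \<open>f z\<close> turns \<open>f (f z y)\<close> into the
    conjugate of \<open>f y\<close> by \<open>f z\<close>, which \<open>BijGroup_conj_apply\<close>
    evaluates at \<open>f z x\<close>.\<close>
  show "f z (f y x) = f (f z y) (f z x)" if "x \<in> X" "y \<in> X" "z \<in> X" for x y z
    using that conj_map_in_G by (simp add: conj_map_equivariant BijGroup_conj_apply)
qed

lemma operators_eq_conjugates:
  "{\<lambda>x \<in> X. f y x | y. y \<in> X} = {perm_conj X g (\<pi> i) | g i. g \<in> G \<and> i \<in> I}"
proof -
  \<comment> \<open>Elements of \<open>BijGroup X\<close> are extensional already, so the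
    restriction in \<open>operator_group\<close> changes nothing.\<close>
  have "(\<lambda>x \<in> X. f y x) = f y" if "y \<in> X" for y
    using bij_prop0[of "f y"] conj_map_in_G[OF that]
    by (simp add: extensional_restrict Bij_imp_extensional)
  then have "{\<lambda>x \<in> X. f y x | y. y \<in> X} = f ` X"
    by (auto simp: image_iff) metis
  also have "f ` X = {perm_conj X g (\<pi> i) | g i. g \<in> G \<and> i \<in> I}"
  proof (intro equalityI subsetI)
    fix p assume "p \<in> f ` X"
    then obtain x where x: "x \<in> X" "p = f x"
      by blast
    obtain i g where "i \<in> I" "g \<in> G" "x = g (\<alpha> i)"
      using x(1) by (rule point_eq_rep_image)
    then show "p \<in> {perm_conj X g (\<pi> i) | g i. g \<in> G \<and> i \<in> I}"
      using x(2) conj_map_rep by blast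
  next
    fix p assume "p \<in> {perm_conj X g (\<pi> i) | g i. g \<in> G \<and> i \<in> I}"
    then obtain g i where gi: "g \<in> G" "i \<in> I" "p = perm_conj X g (\<pi> i)"
      by blast
    then show "p \<in> f ` X"
      using conj_map_rep[OF gi(2,1)] G_apply_in_X \<alpha>_in_X by (metis imageI)
  qed
  finally show ?thesis .
qed

lemma operator_group_eq:
  "operator_group X (\<lambda>x y. f y x)
    = generate (BijGroup X) {perm_conj X g (\<pi> i) | g i. g \<in> G \<and> i \<in> I}"
  by (simp only: operator_group_def operators_eq_conjugates)

lemma operator_group_subset: "operator_group X (\<lambda>x y. f y x) \<subseteq> G"
  unfolding operator_group_eq
  by (rule Sym.generate_subgroup_incl[OF _ subgroup_G]) (auto simp: \<pi>_in_G)

end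

end

theorem theorem3:
  fixes X :: "'a set" and G :: "('a \<Rightarrow> 'a) set" and I :: "'i set"
    and \<alpha> :: "'i \<Rightarrow> 'a" and \<pi> :: "'i \<Rightarrow> 'a \<Rightarrow> 'a"
  assumes "subgroup G (BijGroup X)"
    and "orbit_reps X G I \<alpha>"
    and "\<And>i. i \<in> I \<Longrightarrow> \<pi> i \<in> G"
    and "\<And>i. i \<in> I \<Longrightarrow>
           stabilizer (perm_group X G) (\<lambda>g. g) (\<alpha> i) \<subseteq> centraliser (perm_group X G) (\<pi> i)"
  shows "(\<exists>!f. f \<in> extensional X \<and> is_conj_map X G I \<alpha> \<pi> f) \<and>
    (\<forall>f. is_conj_map X G I \<alpha> \<pi> f \<longrightarrow>
       rack X (\<lambda>x y. f y x) \<and>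
       operator_group X (\<lambda>x y. f y x) \<subseteq> G \<and>
       (G = generate (BijGroup X) {perm_conj X g (\<pi> i) | g i. g \<in> G \<and> i \<in> I} \<longrightarrow>
          operator_group X (\<lambda>x y. f y x) = G))"
proof -
  interpret conj_rack_data X G I \<alpha> \<pi>
    using assms by (rule conj_rack_data.intro)
  show ?thesis
    \<comment> \<open>By \<open>operator_group_eq\<close> the group in the last hypothesis is the
      operator group itself, which settles the equality with \<open>G\<close>.\<close>
    using ex_conj_map conj_map_unique rack_conj_map operator_group_subset operator_group_eq
    by (intro conjI allI impI ex_ex1I) (auto 4 0)
qed

end
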